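(* Let $A\subseteq\mathbb{R}^q$ be a nonempty polyhedron with P-representation $(M,B,a,b,l,u)$, where $M\in\mathbb{R}^{q\times n}$ and $B\in\mathbb{R}^{m\times n}$. Let $B'\in\mathbb{R}^{(n+1)\times(k+q)}$ be the matrix that results from $$\begin{pmatrix} B^{\top} & -B^{\top} & I_n & -I_n & -M^{\top}\\ b^{\top} & -a^{\top} & u^{\top} & -l^{\top} & 0_{(q)}^{\top}\end{pmatrix}$$ by deleting all columns with infinite entries. Then the polar $$A^\circ=\{y\in\mathbb{R}^q \mid \forall\, v\in A:\ y^{\top}v\le 1\}$$ of $A$ has the P-representation $$\left(\begin{pmatrix}0_{(q\times k)} & I_q\end{pmatrix},\ B',\ \begin{pmatrix}0_{(n)}\\ -\infty\end{pmatrix},\ \begin{pmatrix}0_{(n)}\\ 1\end{pmatrix},\ \begin{pmatrix}0_{(k)}\\ -\infty_{(q)}\end{pmatrix},\ \infty_{(k+q)}\right).$$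
   Context: Given matrices $M\in\mathbb{R}^{q\times n}$, $B\in\mathbb{R}^{m\times n}$ and vectors $a\in(\mathbb{R}\cup\{-\infty\})^m$, $b\in(\mathbb{R}\cup\{+\infty\})^m$, $l\in(\mathbb{R}\cup\{-\infty\})^n$, $u\in(\mathbb{R}\cup\{+\infty\})^n$, the set $P=\{Mx \mid x\in\mathbb{R}^n,\ a\le Bx\le b,\ l\le x\le u\}\subseteq\mathbb{R}^q$ (inequalities componentwise) is called a (convex) polyhedron, and the tuple $(M,B,a,b,l,u)$ is called a P-representation of $P$. Notation: $I_n$ is the $n\times n$ identity matrix; $c_{(n)}$ is the $n$-dimensional column vector all of whose components equal $c$; $0_{(q\times k)}$ is the $q\times k$ zero matrix. Here $k\geq 0$ denotes the number of columns of the first four blocks (the $2m+2n$ columns preceding the block containing $-M^{\top}$) that remain after the deletion; the $q$ columns of the last block are all kept, since their entries are finite. *)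

theory Defs
  imports "Jordan_Normal_Form.DL_Submatrix" "HOL-Library.Extended_Real"
begin

definition append_cols :: "'a :: zero mat \<Rightarrow> 'a mat \<Rightarrow> 'a mat" (infixr \<open>@\<^sub>c\<close> 65) where
  "A @\<^sub>c B = four_block_mat A B (0\<^sub>m 0 (dim_col A)) (0\<^sub>m 0 (dim_col B))"

definition const_vec :: "nat \<Rightarrow> 'a \<Rightarrow> 'a vec" where
  "const_vec n c = vec n (\<lambda>_. c)"

(* The order on vectors is componentwise. The dimensions n (variables) and m (constraints)
   may be 0. *)
definition P_representation ::
  "nat \<Rightarrow> nat \<Rightarrow> nat \<Rightarrow>
    real mat \<times> real mat \<times> ereal vec \<times> ereal vec \<times> ereal vec \<times> ereal vec \<Rightarrow>
    real vec set \<Rightarrow> bool" where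
  "P_representation q n m = (\<lambda>(M, B, a, b, l, u) P.
     M \<in> carrier_mat q n \<and> B \<in> carrier_mat m n \<and>
     a \<in> carrier_vec m \<and> \<infinity> \<notin> set\<^sub>v a \<and>
     b \<in> carrier_vec m \<and> -\<infinity> \<notin> set\<^sub>v b \<and>
     l \<in> carrier_vec n \<and> \<infinity> \<notin> set\<^sub>v l \<and>
     u \<in> carrier_vec n \<and> -\<infinity> \<notin> set\<^sub>v u \<and>
     P = {M *\<^sub>v x | x. x \<in> carrier_vec n \<and>
            a \<le> map_vec ereal (B *\<^sub>v x) \<and> map_vec ereal (B *\<^sub>v x) \<le> b \<and>
            l \<le> map_vec ereal x \<and> map_vec ereal x \<le> u})"

definition polar :: "nat \<Rightarrow> real vec set \<Rightarrow> real vec set" where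
  "polar q A = {y \<in> carrier_vec q. \<forall>v\<in>A. y \<bullet> v \<le> 1}"

definition finite_cols :: "ereal mat \<Rightarrow> nat set" where
  "finite_cols A = {j. j < dim_col A \<and> (\<forall>i<dim_row A. \<bar>A $$ (i, j)\<bar> \<noteq> \<infinity>)}"

definition delete_infinite_cols :: "ereal mat \<Rightarrow> real mat" where
  "delete_infinite_cols A = map_mat real_of_ereal (submatrix A UNIV (finite_cols A))"

definition polar_block_mat ::
  "real mat \<Rightarrow> real mat \<Rightarrow> ereal vec \<Rightarrow> ereal vec \<Rightarrow> ereal vec \<Rightarrow> ereal vec \<Rightarrow> ereal mat" where
  "polar_block_mat M B a b l u =
     map_mat ereal
       (B\<^sup>T @\<^sub>c - B\<^sup>T @\<^sub>c 1\<^sub>m (dim_col M) @\<^sub>c - 1\<^sub>m (dim_col M) @\<^sub>c - M\<^sup>T)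
     @\<^sub>r mat_of_row (b @\<^sub>v - a @\<^sub>v u @\<^sub>v - l @\<^sub>v 0\<^sub>v (dim_row M))"

end

theory Submission
  imports Defs
begin

text \<open>
  Write the finite constraints of the representation of \<open>A\<close> as \<open>G\<^sup>T x \<le> h\<close>: every finite bound
  contributes one column \<open>(g, \<eta>)\<close>, standing for \<open>g \<bullet> x \<le> \<eta>\<close>, and an infinite bound says nothing.
  A vector \<open>y\<close> lies in the polar of \<open>A\<close> iff the linear function \<open>x \<mapsto> y \<bullet> M x = (M\<^sup>T y) \<bullet> x\<close> is at
  most 1 on the set \<open>{x. G\<^sup>T x \<le> h}\<close>. This set is nonempty because \<open>A\<close> is, so the affine form of
  Farkas' lemma (\<open>affine_farkas\<close>) turns the universal condition into an existential one: there are
  multipliers \<open>w \<ge> 0\<close> with \<open>G w = M\<^sup>T y\<close> and \<open>h \<bullet> w \<le> 1\<close>. Since the matrix obtained by deleting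
  the infinite columns is the block matrix with rows \<open>(G, -M\<^sup>T)\<close> and \<open>(h\<^sup>T, 0)\<close>, these are exactly the
  constraints that the claimed representation puts on the vector \<open>(w, y)\<close>, and its first matrix
  projects \<open>(w, y)\<close> to \<open>y\<close>.

  Farkas' lemma itself is proved by induction on the number of constraints, with the purely algebraic
  argument due to Bartl, here for subspaces of a space of real functions (\<open>farkas_subspace\<close>).
  The affine form follows by homogenization.
\<close>

section \<open>Farkas' lemma\<close>

text \<open>
  Evaluation at an index \<open>i\<close> plays the role of a linear functional. Working with an arbitrary subspace
  \<open>W\<close> makes the induction short: either the new constraint \<open>k\<close> is redundant for the
  implication and gets multiplier 0, or some \<open>w0 \<in> W\<close> satisfies the constraints in \<open>I\<close> but has
  \<open>w0 p > 0\<close>, hence \<open>w0 k > 0\<close>. In the latter case the induction hypothesis is applied to the subspace of vectors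
  vanishing at \<open>k\<close>, and the multiplier of \<open>k\<close> is the one that makes the identity true at \<open>w0\<close>.
\<close>

lemma farkas_subspace:
  fixes W :: "('j \<Rightarrow> real) set"
  assumes "finite I"
    and "\<And>v w s. v \<in> W \<Longrightarrow> w \<in> W \<Longrightarrow> (\<lambda>j. v j + s * w j) \<in> W"
    and "\<And>w. w \<in> W \<Longrightarrow> (\<forall>i\<in>I. w i \<le> 0) \<Longrightarrow> w p \<le> 0"
  shows "\<exists>y. (\<forall>i\<in>I. 0 \<le> y i) \<and> (\<forall>w\<in>W. w p = (\<Sum>i\<in>I. y i * w i))"
  using assms
proof (induction I arbitrary: W rule: finite_induct)
  case empty
  have "w p = 0" if "w \<in> W" for w
    using empty(2)[OF that] empty(2)[OF empty(1)[OF that that, of "-2"]] by simp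
  then show ?case by simp
next
  case (insert k I)
  show ?case
  proof (cases "\<forall>w\<in>W. (\<forall>i\<in>I. w i \<le> 0) \<longrightarrow> w p \<le> 0")
    case True
    then obtain y where y: "\<forall>i\<in>I. 0 \<le> y i" "\<forall>w\<in>W. w p = (\<Sum>i\<in>I. y i * w i)"
      using insert.IH[of W] insert.prems(1) by blast
    have "(\<Sum>i\<in>I. (y(k := 0)) i * w i) = (\<Sum>i\<in>I. y i * w i)" for w
      using insert.hyps(2) by (intro sum.cong) auto
    then show ?thesis
      using y insert.hyps by (intro exI[of _ "y(k := 0)"]) auto
  next
    case False
    then obtain w0 where w0: "w0 \<in> W" "\<forall>i\<in>I. w0 i \<le> 0" "w0 p > 0" by force
    have k0: "w0 k > 0"
      using insert.prems(2)[OF w0(1)] w0 by force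
    \<comment> \<open>On this subspace the constraint \<open>k\<close> is void, and since \<open>w0 k \<noteq> 0\<close>, subtracting multiples
      of \<open>w0\<close> projects \<open>W\<close> onto it.\<close>
    define W' where "W' = {w \<in> W. w k = 0}"
    have "\<exists>y. (\<forall>i\<in>I. 0 \<le> y i) \<and> (\<forall>w\<in>W'. w p = (\<Sum>i\<in>I. y i * w i))"
    proof (rule insert.IH)
      show "(\<lambda>j. v j + s * w j) \<in> W'" if "v \<in> W'" "w \<in> W'" for v w s
        using that insert.prems(1) by (simp add: W'_def)
      show "w p \<le> 0" if "w \<in> W'" "\<forall>i\<in>I. w i \<le> 0" for w
        using that insert.prems(2)[of w] by (simp add: W'_def)
    qed
    then obtain y where y: "\<forall>i\<in>I. 0 \<le> y i" "\<forall>w\<in>W'. w p = (\<Sum>i\<in>I. y i * w i)"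
      by blast
    define c where "c = (w0 p - (\<Sum>i\<in>I. y i * w0 i)) / w0 k"
    have "(\<Sum>i\<in>I. y i * w0 i) \<le> 0"
      using y(1) w0(2) by (intro sum_nonpos) (simp add: mult_nonneg_nonpos)
    then have c: "c \<ge> 0" using w0(3) k0 by (simp add: c_def)
    have "w p = c * w k + (\<Sum>i\<in>I. y i * w i)" if "w \<in> W" for w
    proof -
      define s where "s = - w k / w0 k"
      have "(\<lambda>j. w j + s * w0 j) \<in> W'"
        using insert.prems(1)[OF that w0(1), of s] k0 by (simp add: W'_def) (simp add: s_def)
      then have "w p + s * w0 p = (\<Sum>i\<in>I. y i * (w i + s * w0 i))"
        using y(2)[rule_format, of "\<lambda>j. w j + s * w0 j"] by simp
      also have "\<dots> = (\<Sum>i\<in>I. y i * w i) + s * (\<Sum>i\<in>I. y i * w0 i)"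
        by (simp add: algebra_simps sum.distrib sum_distrib_left)
      finally have "w p = (\<Sum>i\<in>I. y i * w i) - s * (w0 p - (\<Sum>i\<in>I. y i * w0 i))"
        by (simp add: algebra_simps)
      then show ?thesis by (simp add: s_def c_def)
    qed
    moreover have "(\<Sum>i\<in>I. (y(k := c)) i * w i) = (\<Sum>i\<in>I. y i * w i)" for w
      using insert.hyps(2) by (intro sum.cong) auto
    ultimately show ?thesis
      using y c insert.hyps by (intro exI[of _ "y(k := c)"]) auto
  qed
qed

lemma transpose_scalar_prod:
  fixes G :: "real mat"
  assumes "G \<in> carrier_mat n k" "x \<in> carrier_vec n" "y \<in> carrier_vec k"
  shows "(G\<^sup>T *\<^sub>v x) \<bullet> y = x \<bullet> (G *\<^sub>v y)"
  using transpose_vec_mult_scalar[of G n k y x] assms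
  by (metis comm_scalar_prod mult_mat_vec_carrier transpose_carrier_mat)

lemma scalar_prod_le:
  fixes v w y :: "real vec"
  assumes "v \<le> w" "w \<in> carrier_vec k" "y \<in> carrier_vec k" "0\<^sub>v k \<le> y"
  shows "v \<bullet> y \<le> w \<bullet> y"
  using assms by (auto simp: scalar_prod_def less_eq_vec_def intro!: sum_mono mult_right_mono)

text \<open>
  The multipliers are found by homogenizing with an extra variable \<open>t \<ge> 0\<close>: the implication extends to
  \<open>G\<^sup>T x \<le> t h \<Longrightarrow> c \<bullet> x \<le> t \<delta>\<close>, by scaling if \<open>t > 0\<close> and, if \<open>t = 0\<close>, because \<open>c \<bullet> x > 0\<close>
  would make \<open>c\<close> unbounded on the ray from \<open>x0\<close> in direction \<open>x\<close>. The multiplier of the constraint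
  \<open>t \<ge> 0\<close> is the slack in \<open>h \<bullet> y \<le> \<delta>\<close>. The feasible point \<open>x0\<close> cannot be dropped: if
  \<open>G\<^sup>T x \<le> h\<close> has no solution, the left-hand side holds for every \<open>c\<close>, whereas \<open>G y = c\<close> may be unsolvable.
\<close>

lemma affine_farkas:
  fixes G :: "real mat"
  assumes G: "G \<in> carrier_mat n k" and h: "h \<in> carrier_vec k" and c: "c \<in> carrier_vec n"
    and x0: "x0 \<in> carrier_vec n" "G\<^sup>T *\<^sub>v x0 \<le> h"
  shows "(\<forall>x\<in>carrier_vec n. G\<^sup>T *\<^sub>v x \<le> h \<longrightarrow> c \<bullet> x \<le> \<delta>) \<longleftrightarrow>
    (\<exists>y\<in>carrier_vec k. 0\<^sub>v k \<le> y \<and> G *\<^sub>v y = c \<and> h \<bullet> y \<le> \<delta>)"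
proof
  assume "\<exists>y\<in>carrier_vec k. 0\<^sub>v k \<le> y \<and> G *\<^sub>v y = c \<and> h \<bullet> y \<le> \<delta>"
  then obtain y where y: "y \<in> carrier_vec k" "0\<^sub>v k \<le> y" "G *\<^sub>v y = c" "h \<bullet> y \<le> \<delta>" by blast
  show "\<forall>x\<in>carrier_vec n. G\<^sup>T *\<^sub>v x \<le> h \<longrightarrow> c \<bullet> x \<le> \<delta>"
  proof (intro ballI impI)
    fix x assume x: "x \<in> carrier_vec n" "G\<^sup>T *\<^sub>v x \<le> h"
    have "c \<bullet> x = (G\<^sup>T *\<^sub>v x) \<bullet> y"
      using transpose_scalar_prod[OF G x(1) y(1)] y(3) comm_scalar_prod[OF c x(1)] by simp
    also have "\<dots> \<le> h \<bullet> y" using scalar_prod_le[OF x(2) h y(1,2)] .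
    finally show "c \<bullet> x \<le> \<delta>" using y(4) by simp
  qed
next
  assume bound: "\<forall>x\<in>carrier_vec n. G\<^sup>T *\<^sub>v x \<le> h \<longrightarrow> c \<bullet> x \<le> \<delta>"
  have feasible_iff: "G\<^sup>T *\<^sub>v x \<le> h \<longleftrightarrow> (\<forall>s<k. col G s \<bullet> x \<le> h $ s)" for x
    using G h by (auto simp: less_eq_vec_def)
  \<comment> \<open>Homogenization: coordinates below \<open>k\<close> are the constraints, coordinate \<open>k\<close> is the
    sign condition on the homogenizing variable \<open>t\<close>, and coordinate \<open>k + 1\<close> is the
    inequality to be derived.\<close>
  define w where "w x t = (\<lambda>s. if s < k then col G s \<bullet> x - t * h $ s
    else if s = k then - t else c \<bullet> x - t * \<delta>)" for x t
  define W where "W = {w x t | x t. x \<in> carrier_vec n}"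
  have "\<exists>y. (\<forall>i\<in>{..k}. 0 \<le> y i) \<and> (\<forall>v\<in>W. v (k + 1) = (\<Sum>i\<le>k. y i * v i))"
  proof (rule farkas_subspace)
    fix v v' s assume "v \<in> W" "v' \<in> W"
    then obtain x t x' t' where
      v: "v = w x t" "v' = w x' t'" "x \<in> carrier_vec n" "x' \<in> carrier_vec n"
      by (auto simp: W_def)
    have "(\<lambda>j. v j + s * v' j) = w (x + s \<cdot>\<^sub>v x') (t + s * t')"
      using v c G unfolding v w_def
      by (auto simp: fun_eq_iff scalar_prod_add_distrib[of _ n] algebra_simps)
    then show "(\<lambda>j. v j + s * v' j) \<in> W" using v by (auto simp: W_def)
  next
    fix v assume "v \<in> W" and le: "\<forall>i\<in>{..k}. v i \<le> 0"
    then obtain x t where v: "v = w x t" and x: "x \<in> carrier_vec n" by (auto simp: W_def)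
    have t: "t \<ge> 0" using bspec[OF le, of k] by (simp add: v w_def)
    have Gx: "col G s \<bullet> x \<le> t * h $ s" if "s < k" for s
      using bspec[OF le, of s] that by (simp add: v w_def)
    have "c \<bullet> x \<le> t * \<delta>"
    proof (cases "t = 0")
      case False
      then have t: "t > 0" using t by simp
      have "G\<^sup>T *\<^sub>v (inverse t \<cdot>\<^sub>v x) \<le> h"
        unfolding feasible_iff using Gx t x G by (auto simp: field_simps)
      then have "c \<bullet> (inverse t \<cdot>\<^sub>v x) \<le> \<delta>" using bound x by simp
      then show ?thesis using t x c by (simp add: field_simps)
    next
      case True
      \<comment> \<open>Here \<open>x\<close> is a recession direction, and moving from \<open>x0\<close> along it stays feasible.\<close>
      have ray: "c \<bullet> x0 + r * (c \<bullet> x) \<le> \<delta>" if r: "r \<ge> 0" for r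
      proof -
        have "col G s \<bullet> x0 + r * (col G s \<bullet> x) \<le> h $ s" if "s < k" for s
          using x0(2) Gx[OF that] r that True
            mult_nonneg_nonpos[of r "col G s \<bullet> x"] unfolding feasible_iff by fastforce
        then have "G\<^sup>T *\<^sub>v (x0 + r \<cdot>\<^sub>v x) \<le> h"
          unfolding feasible_iff using x x0 G by (auto simp: scalar_prod_add_distrib[of _ n])
        then have "c \<bullet> (x0 + r \<cdot>\<^sub>v x) \<le> \<delta>" using bound x x0 by simp
        then show ?thesis using x x0 c by (simp add: scalar_prod_add_distrib[of _ n])
      qed
      have "c \<bullet> x \<le> 0"
      proof (rule ccontr)
        assume "\<not> c \<bullet> x \<le> 0"
        then have pos: "c \<bullet> x > 0" by simp
        define r where "r = (\<delta> - c \<bullet> x0 + 1) / (c \<bullet> x)"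
        have "c \<bullet> x0 \<le> \<delta>" using bound x0 by blast
        then have "r \<ge> 0" using pos by (simp add: r_def)
        moreover have "r * (c \<bullet> x) = \<delta> - c \<bullet> x0 + 1" using pos by (simp add: r_def)
        ultimately show False using ray[of r] by simp
      qed
      then show ?thesis using True by simp
    qed
    then show "v (k + 1) \<le> 0" by (simp add: v w_def)
  qed simp
  then obtain y where y0: "\<forall>i\<in>{..k}. 0 \<le> y i"
    and y: "\<forall>v\<in>W. v (k + 1) = (\<Sum>i\<le>k. y i * v i)" by blast
  have split: "(\<Sum>i\<le>k. y i * w x t i) = (\<Sum>i<k. y i * (col G i \<bullet> x - t * h $ i)) - y k * t" for x t
    by (simp add: w_def lessThan_Suc_atMost[symmetric])
  have eq: "c \<bullet> x - t * \<delta> = (\<Sum>i<k. y i * (col G i \<bullet> x - t * h $ i)) - y k * t"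
    if "x \<in> carrier_vec n" for x t
  proof -
    have "w x t \<in> W" using that by (auto simp: W_def)
    then have "w x t (k + 1) = (\<Sum>i\<le>k. y i * w x t i)" using y by blast
    then show ?thesis unfolding split by (simp add: w_def)
  qed
  \<comment> \<open>Unit vectors \<open>x\<close> with \<open>t = 0\<close> compare the coefficients; \<open>x = 0\<close> with \<open>t = 1\<close>
    compares the right-hand sides.\<close>
  have "G *\<^sub>v vec k y = c"
  proof
    fix i assume "i < dim_vec c"
    then have i: "i < n" using c by simp
    have "c $ i = (\<Sum>s<k. y s * (G $$ (i, s)))"
      using eq[of "unit_vec n i" 0] i c G by simp
    then show "(G *\<^sub>v vec k y) $ i = c $ i"
      using i G by (simp add: scalar_prod_def atLeast0LessThan mult.commute)
  qed (use G c in simp)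
  moreover have "h \<bullet> vec k y \<le> \<delta>"
  proof -
    have "(\<Sum>i<k. y i * (col G i \<bullet> 0\<^sub>v n - 1 * h $ i)) = - (h \<bullet> vec k y)"
      using G by (auto simp: scalar_prod_def atLeast0LessThan mult.commute sum_negf[symmetric] intro!: sum.cong)
    then show ?thesis using eq[of "0\<^sub>v n" 1] c bspec[OF y0, of k] by simp
  qed
  ultimately show "\<exists>y\<in>carrier_vec k. 0\<^sub>v k \<le> y \<and> G *\<^sub>v y = c \<and> h \<bullet> y \<le> \<delta>"
    using y0 by (intro bexI[of _ "vec k y"]) (auto simp: less_eq_vec_def)
qed

section \<open>Enumerating the remaining columns\<close>

text \<open>Splits a statement about all columns of a block matrix into one statement per block.\<close>

lemma all_less_add_iff:
  fixes p r :: nat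
  shows "(\<forall>j<p + r. P j) \<longleftrightarrow> (\<forall>j<p. P j) \<and> (\<forall>j<r. P (p + j))"
  by (metis add_less_cancel_left le_add_diff_inverse not_less trans_less_add1)

text \<open>
  The function \<open>pick F\<close> enumerates \<open>F\<close> in increasing order, so the remaining columns with index below
  \<open>N\<close> come first, and if all columns from \<open>N\<close> on are kept, they follow in their old order.
\<close>

lemma pick_initial_segment:
  assumes "finite F"
  shows "pick F ` {..<card {j \<in> F. j < N}} = {j \<in> F. j < N}"
proof (intro subset_antisym subsetI)
  fix j assume j: "j \<in> {j \<in> F. j < N}"
  have "{i \<in> F. i < j} \<subset> {i \<in> F. i < N}" using j by auto
  then have "card {i \<in> F. i < j} < card {j \<in> F. j < N}"
    using assms by (intro psubset_card_mono) auto
  then show "j \<in> pick F ` {..<card {j \<in> F. j < N}}"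
    using pick_card_in_set[of j F] j by (metis (mono_tags, lifting) image_eqI lessThan_iff mem_Collect_eq)
next
  fix j assume "j \<in> pick F ` {..<card {j \<in> F. j < N}}"
  then obtain s where s: "j = pick F s" "s < card {j \<in> F. j < N}" by auto
  have "card {j \<in> F. j < N} \<le> card F" using assms by (intro card_mono) auto
  then have sF: "s < card F" using s by simp
  have "pick F s \<in> F" using pick_in_set_le[OF sF] .
  moreover have "pick F s < N"
  proof (rule ccontr)
    assume "\<not> pick F s < N"
    then have "card {j \<in> F. j < N} \<le> card {j \<in> F. j < pick F s}"
      using assms by (intro card_mono) auto
    then show False using card_pick_le[OF sF] s by simp
  qed
  ultimately show "j \<in> {j \<in> F. j < N}" using s by simp
qed

lemma pick_final_segment:
  assumes F: "F \<subseteq> {..<N + q}" "{N..<N + q} \<subseteq> F" and t: "t < q"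
  shows "pick F (card {j \<in> F. j < N} + t) = N + t"
proof -
  have fin: "finite F" using F(1) finite_subset by blast
  have "{j \<in> F. j < N + t} = {j \<in> F. j < N} \<union> {N..<N + t}" using F t by auto
  then have "card {j \<in> F. j < N + t} = card {j \<in> F. j < N} + t"
    using fin by (simp add: card_Un_disjoint disjoint_iff)
  moreover have "N + t \<in> F" using F t by auto
  ultimately show ?thesis using pick_card_in_set by metis
qed

lemma delete_infinite_cols_dims:
  "dim_row (delete_infinite_cols C) = dim_row C"
  "dim_col (delete_infinite_cols C) = card (finite_cols C)"
  by (auto simp: delete_infinite_cols_def dim_submatrix finite_cols_def intro!: arg_cong[where f = card])

lemma delete_infinite_cols_index:
  assumes "i < dim_row C" "s < card (finite_cols C)"
  shows "delete_infinite_cols C $$ (i, s) = real_of_ereal (C $$ (i, pick (finite_cols C) s))"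
proof -
  have "{j. j < dim_col C \<and> j \<in> finite_cols C} = finite_cols C" by (auto simp: finite_cols_def)
  then show ?thesis
    using assms by (simp add: delete_infinite_cols_def dim_submatrix submatrix_index pick_UNIV)
qed

section \<open>Columns of the block matrix as constraints\<close>

lemma ereal_le_iff_real_of_ereal:
  assumes "b \<noteq> -\<infinity>"
  shows "ereal y \<le> b \<longleftrightarrow> (\<bar>b\<bar> \<noteq> \<infinity> \<longrightarrow> y \<le> real_of_ereal b)"
  using assms by (cases b) auto

lemma ereal_ge_iff_real_of_ereal:
  assumes "a \<noteq> \<infinity>"
  shows "a \<le> ereal y \<longleftrightarrow> (\<bar>- a\<bar> \<noteq> \<infinity> \<longrightarrow> - y \<le> real_of_ereal (- a))"
  using assms by (cases a) auto


lemma polar_block_mat_dims: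
  assumes "M \<in> carrier_mat q n" "B \<in> carrier_mat m n"
  shows "dim_row (polar_block_mat M B a b l u) = n + 1"
    and "dim_col (polar_block_mat M B a b l u) = 2 * m + 2 * n + q"
  using assms by (auto simp: polar_block_mat_def append_rows_def append_cols_def)

lemma polar_block_mat_top:
  assumes "M \<in> carrier_mat q n" "B \<in> carrier_mat m n" "i < n"
  shows "j < m \<Longrightarrow> polar_block_mat M B a b l u $$ (i, j) = ereal (B $$ (j, i))"
    and "j < m \<Longrightarrow> polar_block_mat M B a b l u $$ (i, m + j) = ereal (- B $$ (j, i))"
    and "j < n \<Longrightarrow> polar_block_mat M B a b l u $$ (i, m + m + j) = ereal (1\<^sub>m n $$ (i, j))"
    and "j < n \<Longrightarrow> polar_block_mat M B a b l u $$ (i, m + m + n + j) = ereal (- 1\<^sub>m n $$ (i, j))"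
    and "j < q \<Longrightarrow> polar_block_mat M B a b l u $$ (i, m + m + n + n + j) = ereal (- M $$ (j, i))"
  using assms by (auto simp: polar_block_mat_def append_rows_def append_cols_def)

lemma polar_block_mat_bottom:
  assumes "M \<in> carrier_mat q n" "B \<in> carrier_mat m n"
    and "a \<in> carrier_vec m" "b \<in> carrier_vec m" "l \<in> carrier_vec n" "u \<in> carrier_vec n"
  shows "j < m \<Longrightarrow> polar_block_mat M B a b l u $$ (n, j) = b $ j"
    and "j < m \<Longrightarrow> polar_block_mat M B a b l u $$ (n, m + j) = - a $ j"
    and "j < n \<Longrightarrow> polar_block_mat M B a b l u $$ (n, m + m + j) = u $ j"
    and "j < n \<Longrightarrow> polar_block_mat M B a b l u $$ (n, m + m + n + j) = - l $ j"
    and "j < q \<Longrightarrow> polar_block_mat M B a b l u $$ (n, m + m + n + n + j) = 0"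
  using assms by (auto simp: polar_block_mat_def append_rows_def append_cols_def)

lemma finite_polar_block_mat_top:
  assumes "M \<in> carrier_mat q n" "B \<in> carrier_mat m n" "i < n" "j < 2 * m + 2 * n + q"
  shows "\<bar>polar_block_mat M B a b l u $$ (i, j)\<bar> \<noteq> \<infinity>"
proof -
  have "\<forall>j<m + m + n + n + q. \<bar>polar_block_mat M B a b l u $$ (i, j)\<bar> \<noteq> \<infinity>"
    unfolding all_less_add_iff using polar_block_mat_top[OF assms(1-3)] by simp
  then show ?thesis using assms(4) by simp
qed

lemma finite_cols_polar_block_mat:
  assumes "M \<in> carrier_mat q n" "B \<in> carrier_mat m n"
  shows "finite_cols (polar_block_mat M B a b l u) =
    {j. j < 2 * m + 2 * n + q \<and> \<bar>polar_block_mat M B a b l u $$ (n, j)\<bar> \<noteq> \<infinity>}"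
  unfolding finite_cols_def polar_block_mat_dims[OF assms]
  using finite_polar_block_mat_top[OF assms, of _ _ a b l u] less_Suc_eq[of _ n]
  by (intro Collect_cong) (metis Suc_eq_plus1)

text \<open>
  Each of the first \<open>2 m + 2 n\<close> columns encodes one scalar inequality between its two parts: the columns
  of \<open>B\<^sup>T\<close> over \<open>b\<close> encode \<open>B x \<le> b\<close>, those of \<open>-B\<^sup>T\<close> over \<open>-a\<close> encode \<open>-B x \<le> -a\<close>, and the
  identity blocks do the same for \<open>u\<close> and \<open>l\<close>. As \<open>b, u\<close> avoid \<open>-\<infinity>\<close> and \<open>a, l\<close> avoid \<open>\<infinity>\<close>, a deleted
  column stands for an inequality that always holds.
\<close>

lemma feasible_iff_finite_cols:
  assumes M: "M \<in> carrier_mat q n" and B: "B \<in> carrier_mat m n"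
    and a: "a \<in> carrier_vec m" "\<infinity> \<notin> set\<^sub>v a" and b: "b \<in> carrier_vec m" "-\<infinity> \<notin> set\<^sub>v b"
    and l: "l \<in> carrier_vec n" "\<infinity> \<notin> set\<^sub>v l" and u: "u \<in> carrier_vec n" "-\<infinity> \<notin> set\<^sub>v u"
    and x: "x \<in> carrier_vec n"
  defines "C \<equiv> polar_block_mat M B a b l u"
  shows "a \<le> map_vec ereal (B *\<^sub>v x) \<and> map_vec ereal (B *\<^sub>v x) \<le> b \<and>
      l \<le> map_vec ereal x \<and> map_vec ereal x \<le> u \<longleftrightarrow>
    (\<forall>j\<in>{j \<in> finite_cols C. j < 2 * m + 2 * n}.
      (\<Sum>i<n. real_of_ereal (C $$ (i, j)) * x $ i) \<le> real_of_ereal (C $$ (n, j)))"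
    (is "?feasible \<longleftrightarrow> ?cols")
proof -
  \<comment> \<open>The finiteness guard makes \<open>P\<close> meaningful for all columns, so that the four blocks can be
    treated one by one.\<close>
  define P where "P j \<longleftrightarrow> \<bar>C $$ (n, j)\<bar> \<noteq> \<infinity> \<longrightarrow>
    (\<Sum>i<n. real_of_ereal (C $$ (i, j)) * x $ i) \<le> real_of_ereal (C $$ (n, j))" for j
  note top = polar_block_mat_top[OF M B, of _ _ a b l u, folded C_def]
  note bottom = polar_block_mat_bottom[OF M B a(1) b(1) l(1) u(1), folded C_def]
  have Bx: "(B *\<^sub>v x) $ j = (\<Sum>i<n. B $$ (j, i) * x $ i)" if "j < m" for j
    using that B x by (simp add: scalar_prod_def atLeast0LessThan)
  have unit: "(\<Sum>i<n. 1\<^sub>m n $$ (i, j) * x $ i) = x $ j" if "j < n" for j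
  proof -
    have "(\<Sum>i<n. 1\<^sub>m n $$ (i, j) * x $ i) = (\<Sum>i<n. if i = j then x $ i else 0)"
      using that by (intro sum.cong) auto
    then show ?thesis using that by simp
  qed
  have ab: "a $ j \<noteq> \<infinity>" "b $ j \<noteq> -\<infinity>" if "j < m" for j
    using a b that by (metis carrier_vecD vec_setI)+
  have lu: "l $ j \<noteq> \<infinity>" "u $ j \<noteq> -\<infinity>" if "j < n" for j
    using l u that by (metis carrier_vecD vec_setI)+
  have "P j \<longleftrightarrow> ereal ((B *\<^sub>v x) $ j) \<le> b $ j" if "j < m" for j
    using that top(1)[OF _ that] bottom(1)[OF that]
    by (simp add: P_def Bx ereal_le_iff_real_of_ereal ab)
  moreover have "P (m + j) \<longleftrightarrow> a $ j \<le> ereal ((B *\<^sub>v x) $ j)" if "j < m" for j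
    using that top(2)[OF _ that] bottom(2)[OF that]
    by (simp add: P_def Bx ereal_ge_iff_real_of_ereal ab sum_negf)
  moreover have "P (m + m + j) \<longleftrightarrow> ereal (x $ j) \<le> u $ j" if "j < n" for j
    using that top(3)[OF _ that] bottom(3)[OF that] unit[OF that]
    by (simp add: P_def ereal_le_iff_real_of_ereal lu)
  moreover have "P (m + m + n + j) \<longleftrightarrow> l $ j \<le> ereal (x $ j)" if "j < n" for j
    using that top(4)[OF _ that] bottom(4)[OF that] unit[OF that]
    by (simp add: P_def ereal_ge_iff_real_of_ereal lu sum_negf)
  ultimately have "(\<forall>j<m + m + n + n. P j) \<longleftrightarrow> ?feasible"
    unfolding all_less_add_iff using B a b l u x by (auto simp: less_eq_vec_def)
  moreover have "(\<forall>j<m + m + n + n. P j) \<longleftrightarrow> ?cols"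
  proof -
    have "{j \<in> finite_cols C. j < 2 * m + 2 * n} = {j. j < m + m + n + n \<and> \<bar>C $$ (n, j)\<bar> \<noteq> \<infinity>}"
      unfolding C_def finite_cols_polar_block_mat[OF M B] by auto
    then show ?thesis by (simp only: P_def Ball_def mem_Collect_eq imp_conjL)
  qed
  ultimately show ?thesis by simp
qed

section \<open>The polar of a polyhedron\<close>

theorem proposition8:
  fixes q n m k :: nat
    and M B B' :: "real mat"
    and a b l u :: "ereal vec"
    and A :: "real vec set"
  assumes "P_representation q n m (M, B, a, b, l, u) A"
    and "A \<noteq> {}"
    and "B' = delete_infinite_cols (polar_block_mat M B a b l u)"
    and "k = card {j \<in> finite_cols (polar_block_mat M B a b l u). j < 2 * m + 2 * n}"
  shows "P_representation q (k + q) (n + 1)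
           (0\<^sub>m q k @\<^sub>c 1\<^sub>m q,
            B',
            const_vec n 0 @\<^sub>v const_vec 1 (-\<infinity>),
            const_vec n 0 @\<^sub>v const_vec 1 1,
            const_vec k 0 @\<^sub>v const_vec q (-\<infinity>),
            const_vec (k + q) \<infinity>)
           (polar q A)"
proof -
  define C where "C = polar_block_mat M B a b l u"
  define F where "F = finite_cols C"
  define N where "N = 2 * m + 2 * n"
  define feasible where "feasible x \<longleftrightarrow> a \<le> map_vec ereal (B *\<^sub>v x) \<and>
    map_vec ereal (B *\<^sub>v x) \<le> b \<and> l \<le> map_vec ereal x \<and> map_vec ereal x \<le> u" for x
  have M: "M \<in> carrier_mat q n" and B: "B \<in> carrier_mat m n"
    and a: "a \<in> carrier_vec m" "\<infinity> \<notin> set\<^sub>v a" and b: "b \<in> carrier_vec m" "-\<infinity> \<notin> set\<^sub>v b"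
    and l: "l \<in> carrier_vec n" "\<infinity> \<notin> set\<^sub>v l" and u: "u \<in> carrier_vec n" "-\<infinity> \<notin> set\<^sub>v u"
    and A: "A = {M *\<^sub>v x | x. x \<in> carrier_vec n \<and> feasible x}"
    using assms(1) by (auto simp: P_representation_def feasible_def)
  note top = polar_block_mat_top[OF M B, of _ _ a b l u, folded C_def]
  note bottom = polar_block_mat_bottom[OF M B a(1) b(1) l(1) u(1), folded C_def]
  have F_eq: "F = {j. j < N + q \<and> \<bar>C $$ (n, j)\<bar> \<noteq> \<infinity>}"
    unfolding F_def C_def N_def by (rule finite_cols_polar_block_mat[OF M B])
  have k: "k = card {j \<in> F. j < N}" using assms(4) by (simp add: F_def C_def N_def)
  have N: "N = m + m + n + n" by (simp add: N_def)
  have last_cols: "{N..<N + q} \<subseteq> F"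
  proof
    fix j assume j: "j \<in> {N..<N + q}"
    then have "C $$ (n, j) = 0" using bottom(5)[of "j - N"] by (auto simp: N)
    then show "j \<in> F" using j by (simp add: F_eq)
  qed
  have fin: "finite F" by (simp add: F_eq)
  have "F = {j \<in> F. j < N} \<union> {N..<N + q}" using last_cols by (auto simp: F_eq)
  moreover have "card ({j \<in> F. j < N} \<union> {N..<N + q}) = k + q"
    using fin unfolding k by (subst card_Un_disjoint) auto
  ultimately have card_F: "card F = k + q" by simp
  have B'_carrier: "B' \<in> carrier_mat (n + 1) (k + q)"
    unfolding assms(3) C_def[symmetric]
    by (rule carrier_matI)
      (simp_all add: delete_infinite_cols_dims card_F[unfolded F_def C_def] polar_block_mat_dims[OF M B] C_def)
  have B'_index: "B' $$ (i, s) = real_of_ereal (C $$ (i, pick F s))" if "i < n + 1" "s < k + q" for i s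
    using that card_F polar_block_mat_dims[OF M B] unfolding assms(3) C_def[symmetric] F_def
    by (subst delete_infinite_cols_index) (simp_all add: C_def)
  have pick_last: "pick F (k + t) = N + t" if "t < q" for t
    unfolding k using last_cols that by (intro pick_final_segment) (auto simp: F_eq)

  define G where "G = mat n k (\<lambda>(i, s). B' $$ (i, s))"
  define h where "h = vec k (\<lambda>s. B' $$ (n, s))"
  have G: "G \<in> carrier_mat n k" and h: "h \<in> carrier_vec k" by (simp_all add: G_def h_def)
  have B'_blocks: "B' = four_block_mat G (- M\<^sup>T) (mat_of_row h) (0\<^sub>m 1 q)"
  proof (rule eq_matI)
    fix i s
    assume "i < dim_row (four_block_mat G (- M\<^sup>T) (mat_of_row h) (0\<^sub>m 1 q))"
      and "s < dim_col (four_block_mat G (- M\<^sup>T) (mat_of_row h) (0\<^sub>m 1 q))"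
    then have i: "i < n + 1" and s: "s < k + q" by (simp_all add: G_def)
    show "B' $$ (i, s) = four_block_mat G (- M\<^sup>T) (mat_of_row h) (0\<^sub>m 1 q) $$ (i, s)"
    proof (cases "s < k")
      case True
      then show ?thesis using i s by (auto simp: G_def h_def less_Suc_eq)
    next
      case False
      define t where "t = s - k"
      have t: "t < q" "s = k + t" using False s by (auto simp: t_def)
      show ?thesis
        using i s t M B'_index[OF i s] pick_last[OF t(1)] top(5)[of i t] bottom(5)[OF t(1)]
        by (auto simp: G_def h_def N less_Suc_eq)
    qed
  qed (use B'_carrier G h in auto)
  have feasible_iff: "feasible x \<longleftrightarrow> G\<^sup>T *\<^sub>v x \<le> h" if x: "x \<in> carrier_vec n" for x
  proof -
    have "feasible x \<longleftrightarrow> (\<forall>j\<in>pick F ` {..<k}.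
        (\<Sum>i<n. real_of_ereal (C $$ (i, j)) * x $ i) \<le> real_of_ereal (C $$ (n, j)))"
      using feasible_iff_finite_cols[OF M B a b l u x] pick_initial_segment[OF fin, of N]
      by (simp add: feasible_def C_def F_def k N_def)
    also have "\<dots> \<longleftrightarrow> (\<forall>s<k. (\<Sum>i<n. B' $$ (i, s) * x $ i) \<le> B' $$ (n, s))"
      by (simp add: B'_index) (simp only: Ball_def lessThan_iff)
    also have "\<dots> \<longleftrightarrow> G\<^sup>T *\<^sub>v x \<le> h"
      using x by (simp add: less_eq_vec_def scalar_prod_def atLeast0LessThan G_def h_def)
    finally show ?thesis .
  qed
  obtain x0 where x0: "x0 \<in> carrier_vec n" "G\<^sup>T *\<^sub>v x0 \<le> h"
    using assms(2) feasible_iff by (auto simp: A)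
  have polar_iff: "y \<in> polar q A \<longleftrightarrow>
      (\<exists>w\<in>carrier_vec k. 0\<^sub>v k \<le> w \<and> G *\<^sub>v w = M\<^sup>T *\<^sub>v y \<and> h \<bullet> w \<le> 1)"
    if y: "y \<in> carrier_vec q" for y
  proof -
    have "y \<in> polar q A \<longleftrightarrow> (\<forall>x\<in>carrier_vec n. feasible x \<longrightarrow> y \<bullet> (M *\<^sub>v x) \<le> 1)"
      using y by (simp only: polar_def A) auto
    also have "\<dots> \<longleftrightarrow>
        (\<forall>x\<in>carrier_vec n. G\<^sup>T *\<^sub>v x \<le> h \<longrightarrow> (M\<^sup>T *\<^sub>v y) \<bullet> x \<le> 1)"
      by (intro ball_cong refl) (simp only: feasible_iff transpose_scalar_prod[OF M y])
    finally show ?thesis using affine_farkas[OF G h _ x0] M y by simp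
  qed
  \<comment> \<open>The constraints of the claimed representation, for \<open>z\<close> composed of multipliers and \<open>y\<close>: the
    first \<open>n\<close> rows are equations, the last row has only an upper bound, and only the multipliers
    have a finite lower bound.\<close>
  define constraints where "constraints z \<longleftrightarrow>
      const_vec n 0 @\<^sub>v const_vec 1 (-\<infinity>) \<le> map_vec ereal (B' *\<^sub>v z) \<and>
      map_vec ereal (B' *\<^sub>v z) \<le> const_vec n 0 @\<^sub>v const_vec 1 1 \<and>
      const_vec k 0 @\<^sub>v const_vec q (-\<infinity>) \<le> map_vec ereal z \<and>
      map_vec ereal z \<le> const_vec (k + q) \<infinity>" for z
  have constraints_iff: "constraints (w @\<^sub>v y) \<longleftrightarrow>
      0\<^sub>v k \<le> w \<and> G *\<^sub>v w = M\<^sup>T *\<^sub>v y \<and> h \<bullet> w \<le> 1"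
    if w: "w \<in> carrier_vec k" and y: "y \<in> carrier_vec q" for w y
  proof -
    have "B' *\<^sub>v (w @\<^sub>v y) =
        (G *\<^sub>v w + (- M\<^sup>T) *\<^sub>v y) @\<^sub>v (mat_of_row h *\<^sub>v w + 0\<^sub>m 1 q *\<^sub>v y)"
      unfolding B'_blocks using G M h w y
      by (intro four_block_mat_mult_vec) auto
    also have "\<dots> = (G *\<^sub>v w - M\<^sup>T *\<^sub>v y) @\<^sub>v vec 1 (\<lambda>_. h \<bullet> w)"
      using G M h w y by (intro arg_cong2[of _ _ _ _ append_vec] eq_vecI) auto
    finally have B'z: "B' *\<^sub>v (w @\<^sub>v y) = (G *\<^sub>v w - M\<^sup>T *\<^sub>v y) @\<^sub>v vec 1 (\<lambda>_. h \<bullet> w)" .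
    have "const_vec n 0 @\<^sub>v const_vec 1 (-\<infinity>) \<le> map_vec ereal (B' *\<^sub>v (w @\<^sub>v y)) \<and>
        map_vec ereal (B' *\<^sub>v (w @\<^sub>v y)) \<le> const_vec n 0 @\<^sub>v const_vec 1 1 \<longleftrightarrow>
        (\<forall>i<n. (G *\<^sub>v w) $ i = (M\<^sup>T *\<^sub>v y) $ i) \<and> h \<bullet> w \<le> 1"
      using G M w y unfolding B'z
      by (auto simp: less_eq_vec_def const_vec_def less_Suc_eq simp del: index_mult_mat_vec intro: antisym)
    moreover have "const_vec k 0 @\<^sub>v const_vec q (-\<infinity>) \<le> map_vec ereal (w @\<^sub>v y) \<and>
        map_vec ereal (w @\<^sub>v y) \<le> const_vec (k + q) \<infinity> \<longleftrightarrow> 0\<^sub>v k \<le> w"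
      using w y by (auto simp: less_eq_vec_def const_vec_def)
    moreover have "(\<forall>i<n. (G *\<^sub>v w) $ i = (M\<^sup>T *\<^sub>v y) $ i) \<longleftrightarrow> G *\<^sub>v w = M\<^sup>T *\<^sub>v y"
      using G M by (auto simp: vec_eq_iff simp del: index_mult_mat_vec)
    ultimately show ?thesis by (auto simp: constraints_def)
  qed
  have proj: "(0\<^sub>m q k @\<^sub>c 1\<^sub>m q) *\<^sub>v (w @\<^sub>v y) = y"
    if w: "w \<in> carrier_vec k" and y: "y \<in> carrier_vec q" for w y :: "real vec"
  proof -
    have "(0\<^sub>m q k @\<^sub>c 1\<^sub>m q) *\<^sub>v (w @\<^sub>v y) =
        (0\<^sub>m q k *\<^sub>v w + 1\<^sub>m q *\<^sub>v y) @\<^sub>v (0\<^sub>m 0 k *\<^sub>v w + 0\<^sub>m 0 q *\<^sub>v y)"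
      unfolding append_cols_def index_zero_mat index_one_mat using w y
      by (intro four_block_mat_mult_vec) auto
    also have "\<dots> = y" using w y by (intro eq_vecI) auto
    finally show ?thesis .
  qed
  have "polar q A = {(0\<^sub>m q k @\<^sub>c 1\<^sub>m q) *\<^sub>v z | z. z \<in> carrier_vec (k + q) \<and> constraints z}"
  proof (intro subset_antisym subsetI)
    fix y assume y: "y \<in> polar q A"
    then have yq: "y \<in> carrier_vec q" by (simp add: polar_def)
    then obtain w where w: "w \<in> carrier_vec k" "constraints (w @\<^sub>v y)"
      using y polar_iff constraints_iff by blast
    then show "y \<in> {(0\<^sub>m q k @\<^sub>c 1\<^sub>m q) *\<^sub>v z | z. z \<in> carrier_vec (k + q) \<and> constraints z}"
      using proj[OF w(1) yq] yq by (intro CollectI exI[of _ "w @\<^sub>v y"]) auto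
  next
    fix y assume "y \<in> {(0\<^sub>m q k @\<^sub>c 1\<^sub>m q) *\<^sub>v z | z. z \<in> carrier_vec (k + q) \<and> constraints z}"
    then obtain z where z: "z \<in> carrier_vec (k + q)" "constraints z"
      and y: "y = (0\<^sub>m q k @\<^sub>c 1\<^sub>m q) *\<^sub>v z" by blast
    define w where "w = vec_first z k"
    define y' where "y' = vec_last z q"
    have zw: "z = w @\<^sub>v y'" and wy: "w \<in> carrier_vec k" "y' \<in> carrier_vec q"
      using z(1) by (simp_all add: w_def y'_def)
    then show "y \<in> polar q A"
      using z(2) proj[OF wy] polar_iff[OF wy(2)] constraints_iff[OF wy] by (auto simp: y)
  qed
  moreover have "0\<^sub>m q k @\<^sub>c 1\<^sub>m q \<in> carrier_mat q (k + q)"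
    by (rule carrier_matI) (simp_all add: append_cols_def)
  moreover have "const_vec n 0 @\<^sub>v const_vec 1 c \<in> carrier_vec (n + 1)" for c :: ereal
    by (rule carrier_vecI) (simp add: const_vec_def)
  moreover have "const_vec k 0 @\<^sub>v const_vec q (-\<infinity>) \<in> carrier_vec (k + q)"
    and "const_vec (k + q) \<infinity> \<in> carrier_vec (k + q)"
    by (rule carrier_vecI, simp add: const_vec_def)+
  moreover have "\<infinity> \<notin> set\<^sub>v (const_vec n 0 @\<^sub>v const_vec 1 (-\<infinity>) :: ereal vec)"
    and "-\<infinity> \<notin> set\<^sub>v (const_vec n 0 @\<^sub>v const_vec 1 1 :: ereal vec)"
    and "\<infinity> \<notin> set\<^sub>v (const_vec k 0 @\<^sub>v const_vec q (-\<infinity>) :: ereal vec)"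
    and "-\<infinity> \<notin> set\<^sub>v (const_vec (k + q) \<infinity> :: ereal vec)"
    by (auto simp: const_vec_def vec_set_def)
  ultimately show ?thesis
    using B'_carrier unfolding P_representation_def constraints_def prod.case
    by (intro conjI) assumption+
qed

end
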